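(* Let $f(t)$ be the characteristic function of a non-degenerate $m$-divisible symmetric probability distribution on $\mathbb{R}$ ($m$ a positive integer) with finite tenth moment. Let $a_k$, $k=1,\dots,10$, be its absolute moments and $\sigma$ its standard deviation. Then there is a constant $C>0$, depending only on the absolute moments $a_1,\dots,a_{10}$ (in particular, not on $m$), such that $$\cos^m\!\left(\frac{\sigma t}{\sqrt m}\right)\le f(t)$$ for all real $t$ with $|t|\le\min\left(C\sqrt m,\ \dfrac{\pi\sqrt m}{2\sigma}\right)$.
   Context: A characteristic function $f$ (or the corresponding distribution) is called $m$-divisible, for a positive integer $m$, if $f^{1/m}$ is also a characteristic function, i.e. there is a characteristic function $g$ of a probability distribution on $\mathbb{R}$ with $g^m=f$. A distribution on $\mathbb{R}$ is symmetric if it is invariant under $x\mapsto -x$; equivalently, its characteristic function is real-valued and even. The $k$-th absolute moment of the law of $X$ is $a_k=\mathbb{E}|X|^k$. *)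

theory Defs
  imports "HOL-Probability.Probability"
begin

text \<open>Probability distributions on the real line are measures satisfying the library locale
  \<^locale>\<open>real_distribution\<close>; their characteristic function is \<^const>\<open>char\<close>.\<close>

text \<open>The \<open>m\<close>-th root \<open>g\<close> of a characteristic function may be any characteristic function,
  it is not assumed to be real-valued.\<close>

definition m_divisible :: "nat \<Rightarrow> real measure \<Rightarrow> bool" where
  "m_divisible m M \<longleftrightarrow>
     (\<exists>N. real_distribution N \<and> (\<forall>t. char N t ^ m = char M t))"

definition symmetric_distribution :: "real measure \<Rightarrow> bool" where
  "symmetric_distribution M \<longleftrightarrow> distr M borel uminus = M"

definition degenerate_distribution :: "real measure \<Rightarrow> bool" where
  "degenerate_distribution M \<longleftrightarrow> (\<exists>c. M = return borel c)"

definition finite_moment :: "real measure \<Rightarrow> nat \<Rightarrow> bool" where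
  "finite_moment M k \<longleftrightarrow> integrable M (\<lambda>x. \<bar>x\<bar> ^ k)"

definition abs_moment :: "real measure \<Rightarrow> nat \<Rightarrow> real" where
  "abs_moment M k = prob_space.expectation M (\<lambda>x. \<bar>x\<bar> ^ k)"

definition std_dev :: "real measure \<Rightarrow> real" where
  "std_dev M = sqrt (prob_space.variance M (\<lambda>x. x))"

end

theory Submission
  imports Defs "HOL-Real_Asymp.Real_Asymp"
begin

text \<open>Write \<open>f = g ^ m\<close> with \<open>g\<close> the characteristic function of \<open>Y\<close>. Fatou's lemma applied to
  \<open>2 * (1 - cos (h * Y)) / h\<^sup>2\<close> as \<open>h \<rightarrow> 0\<close> gives \<open>E Y\<^sup>2 \<le> \<sigma>\<^sup>2 / m\<close>. For \<open>0 < a \<le> pi / 2\<close> the even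
  parabola that touches \<open>cos\<close> at \<open>a\<close> lies below \<open>cos\<close> on the whole line; taking expectations yields
  \<open>Re (g t) \<ge> cos (\<sigma> * t / sqrt m)\<close> as long as the argument of the cosine is at most \<open>pi / 2\<close>. There
  \<open>g\<close> stays in the right half plane and \<open>g ^ m\<close> is real, so the continuous argument of \<open>g\<close>, taking
  values in a discrete set, vanishes; hence \<open>g\<close> is real and one may raise to the \<open>m\<close>-th power.
  The bound holds up to \<open>pi * sqrt m / (2 * \<sigma>)\<close>, so \<open>C = 1\<close> serves.\<close>

section \<open>Sine and cosine inequalities\<close>

lemma mult_cos_le_sin:
  fixes x :: real
  assumes "0 \<le> x" "x \<le> pi"
  shows "x * cos x \<le> sin x"
proof -
  have "(\<lambda>x. sin x - x * cos x) 0 \<le> (\<lambda>x. sin x - x * cos x) x"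
  proof (rule DERIV_nonneg_imp_nondecreasing[OF assms(1)])
    fix y assume "0 \<le> y" "y \<le> x"
    then show "\<exists>d. ((\<lambda>x. sin x - x * cos x) has_real_derivative d) (at y) \<and> 0 \<le> d"
      using assms by (intro exI[of _ "y * sin y"] conjI)
        (auto intro!: derivative_eq_intros mult_nonneg_nonneg sin_ge_zero)
  qed
  then show ?thesis by simp
qed

text \<open>This is the decrease of sin x / x on [0, pi], cross-multiplied so that 0 is no
  exception. The derivative in \<open>b\<close> is sin a - a cos b; as cos decreases, it is smallest
  at b = a, where the previous lemma applies.\<close>

lemma mult_sin_antimono:
  fixes a b :: real
  assumes "0 \<le> a" "a \<le> b" "b \<le> pi"
  shows "a * sin b \<le> b * sin a"
proof -
  have "(\<lambda>b. b * sin a - a * sin b) a \<le> (\<lambda>b. b * sin a - a * sin b) b"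
  proof (rule DERIV_nonneg_imp_nondecreasing[OF assms(2)])
    fix y assume y: "a \<le> y" "y \<le> b"
    have "a * cos y \<le> a * cos a"
      using assms y by (intro mult_left_mono cos_monotone_0_pi_le) auto
    also have "\<dots> \<le> sin a"
      using assms by (intro mult_cos_le_sin) auto
    finally show "\<exists>d. ((\<lambda>b. b * sin a - a * sin b) has_real_derivative d) (at y) \<and> 0 \<le> d"
      by (intro exI[of _ "sin a - a * cos y"] conjI) (auto intro!: derivative_eq_intros)
  qed
  then show ?thesis by simp
qed

text \<open>The difference \<open>D\<close> of cosine and parabola vanishes at \<open>a\<close>, and
  for x >= 0 its derivative has the sign of x sin a - a sin x. Since sin x / x decreases,
  \<open>D\<close> falls before \<open>a\<close> and rises after it, so its minimum is 0. Evenness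
  covers negative x.\<close>

lemma cos_ge_tangent_parabola:
  fixes a x :: real
  assumes a: "0 < a" "a \<le> pi / 2"
  shows "cos a - sin a / (2 * a) * (x\<^sup>2 - a\<^sup>2) \<le> cos x"
proof -
  define D where "D = (\<lambda>x. cos x - cos a + sin a / (2 * a) * (x\<^sup>2 - a\<^sup>2))"
  have D': "(D has_real_derivative (x * sin a - a * sin x) / a) (at x)" for x
    unfolding D_def using a by (auto intro!: derivative_eq_intros simp: field_simps)
  have "0 \<le> D x" if x: "0 \<le> x" for x
  proof (cases "x \<le> a")
    case True
    have "D a \<le> D x"
    proof (rule DERIV_nonpos_imp_nonincreasing[OF True])
      fix y assume "x \<le> y" "y \<le> a"
      then have "y * sin a \<le> a * sin y"
        using a x by (intro mult_sin_antimono) auto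
      then show "\<exists>d. (D has_real_derivative d) (at y) \<and> d \<le> 0"
        using a by (intro exI[of _ "(y * sin a - a * sin y) / a"] conjI D')
          (simp add: divide_le_0_iff)
    qed
    then show ?thesis by (simp add: D_def)
  next
    case False
    then have "a \<le> x" by simp
    then have "D a \<le> D x"
    proof (rule DERIV_nonneg_imp_nondecreasing)
      fix y assume y: "a \<le> y" "y \<le> x"
      have "a * sin y \<le> y * sin a"
      proof (cases "y \<le> pi")
        case True
        then show ?thesis using a y by (intro mult_sin_antimono) auto
      next
        case False
        \<comment> \<open>Beyond pi the monotonicity of sin x / x is not at hand. The detour goes
          through pi / 2, where the sine is maximal; it relies on a <= pi / 2.\<close>
        have "a * sin y \<le> a * sin (pi / 2)" using a by simp
        also have "\<dots> \<le> pi / 2 * sin a" using a by (intro mult_sin_antimono) auto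
        also have "\<dots> \<le> y * sin a" using a False by (intro mult_right_mono sin_ge_zero) auto
        finally show ?thesis .
      qed
      then show "\<exists>d. (D has_real_derivative d) (at y) \<and> 0 \<le> d"
        using a by (intro exI[of _ "(y * sin a - a * sin y) / a"] conjI D') simp
    qed
    then show ?thesis by (simp add: D_def)
  qed
  from this[of "\<bar>x\<bar>"] show ?thesis by (simp add: D_def)
qed

section \<open>Lower bounds for the real part of a characteristic function\<close>

lemma (in real_distribution) Re_char: "Re (char M t) = expectation (\<lambda>x. cos (t * x))"
proof -
  have "integrable M (\<lambda>x. iexp (t * x))"
    using integrable_iexp[of "\<lambda>x. complex_of_real (t * x)"] by simp
  from integral_Re[OF this] show ?thesis
    unfolding char_def by (simp add: Re_exp)
qed

lemma (in real_distribution) integrable_cos_mult: "integrable M (\<lambda>x. cos (t * x))"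
  by (rule integrable_const_bound[of _ 1]) auto

text \<open>Integrate 1 - cos y = 2 sin^2 (y / 2) <= y^2 / 2 at y = t x.\<close>

lemma (in real_distribution) Re_char_ge_quadratic:
  assumes "integrable M (\<lambda>x. x\<^sup>2)"
  shows "1 - t\<^sup>2 * expectation (\<lambda>x. x\<^sup>2) / 2 \<le> Re (char M t)"
proof -
  have "1 - t\<^sup>2 * expectation (\<lambda>x. x\<^sup>2) / 2 = expectation (\<lambda>x. 1 - t\<^sup>2 / 2 * x\<^sup>2)"
    using assms prob_space by simp
  also have "\<dots> \<le> Re (char M t)"
    unfolding Re_char
  proof (rule integral_mono)
    fix x
    have "2 * (sin (t * x / 2))\<^sup>2 \<le> 2 * (t * x / 2)\<^sup>2"
      using abs_sin_x_le_abs_x[of "t * x / 2"] by (simp only: abs_le_square_iff mult_le_cancel_left_pos)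
    then show "1 - t\<^sup>2 / 2 * x\<^sup>2 \<le> cos (t * x)"
      using cos_double_sin[of "t * x / 2"] by (simp add: power2_eq_square)
  qed (use assms in \<open>auto intro: integrable_cos_mult\<close>)
  finally show ?thesis .
qed

text \<open>The parabola touching cos at a = |s t| has expectation exactly cos a if the second
  moment is s^2, and a larger or equal one if it is smaller, because its leading coefficient is
  nonpositive. At a = 0 the coefficient divides by zero, so the quadratic bound takes over.\<close>

lemma (in real_distribution) Re_char_ge_cos:
  assumes int: "integrable M (\<lambda>x. x\<^sup>2)" and s: "expectation (\<lambda>x. x\<^sup>2) \<le> s\<^sup>2"
    and t: "\<bar>s * t\<bar> \<le> pi / 2"
  shows "cos (s * t) \<le> Re (char M t)"
proof (cases "s * t = 0")
  case True
  then have "s = 0 \<or> t = 0" by simp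
  then have "t\<^sup>2 * expectation (\<lambda>x. x\<^sup>2) \<le> 0"
    using s by (auto intro: mult_nonneg_nonpos)
  then show ?thesis
    unfolding True using Re_char_ge_quadratic[OF int, of t] by simp
next
  case False
  define a where "a = \<bar>s * t\<bar>"
  have a: "0 < a" "a \<le> pi / 2" using False t by (auto simp: a_def)
  have k: "0 \<le> sin a / (2 * a)"
    using a by (intro divide_nonneg_pos sin_ge_zero) auto
  have "t\<^sup>2 * expectation (\<lambda>x. x\<^sup>2) \<le> t\<^sup>2 * s\<^sup>2"
    using s by (intro mult_left_mono) auto
  then have "t\<^sup>2 * expectation (\<lambda>x. x\<^sup>2) - a\<^sup>2 \<le> 0"
    by (simp add: a_def power_mult_distrib mult.commute)
  with k have "sin a / (2 * a) * (t\<^sup>2 * expectation (\<lambda>x. x\<^sup>2) - a\<^sup>2) \<le> 0"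
    by (rule mult_nonneg_nonpos)
  then have "cos a \<le> cos a - sin a / (2 * a) * (t\<^sup>2 * expectation (\<lambda>x. x\<^sup>2) - a\<^sup>2)" by simp
  also have "\<dots> = expectation (\<lambda>x. cos a - sin a / (2 * a) * (t\<^sup>2 * x\<^sup>2 - a\<^sup>2))"
    using int prob_space by simp
  also have "\<dots> \<le> Re (char M t)"
    unfolding Re_char
  proof (rule integral_mono)
    show "cos a - sin a / (2 * a) * (t\<^sup>2 * x\<^sup>2 - a\<^sup>2) \<le> cos (t * x)" for x
      using cos_ge_tangent_parabola[OF a, of "t * x"] by (simp add: power_mult_distrib)
  qed (use int in \<open>auto intro: integrable_cos_mult\<close>)
  finally show ?thesis by (simp add: a_def)
qed

section \<open>Realness and second moment of a root\<close>

lemma Im_eq_0_if_power_real: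
  fixes g :: "real \<Rightarrow> complex"
  assumes S: "connected S" "0 \<in> S" and cont: "continuous_on S g" and g0: "g 0 = 1"
    and pos: "\<And>t. t \<in> S \<Longrightarrow> 0 < Re (g t)"
    and real: "\<And>t. t \<in> S \<Longrightarrow> Im (g t ^ m) = 0" and m: "m \<ge> 1" and t: "t \<in> S"
  shows "Im (g t) = 0"
proof -
  \<comment> \<open>This is \<open>m\<close> times the principal argument of \<open>g\<close> in
    units of pi: an integer, as \<open>g ^ m\<close> is real, and continuous, as the right half
    plane avoids the cut of \<open>Ln\<close>.\<close>
  define \<theta> where "\<theta> = (\<lambda>t. Im (Ln (g t)) * real m / pi)"
  have nz: "g u \<noteq> 0" "g u \<notin> \<real>\<^sub>\<le>\<^sub>0" if "u \<in> S" for u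
    using pos[OF that] by (auto simp: complex_nonpos_Reals_iff)
  have \<theta>: "\<theta> u \<in> \<int>" if u: "u \<in> S" for u
  proof -
    have "g u ^ m = exp (of_nat m * Ln (g u))"
      using nz[OF u] by (simp add: exp_of_nat_mult)
    then have "sin (real m * Im (Ln (g u))) = 0"
      using real[OF u] by (simp add: Im_exp)
    then obtain i :: int where "real m * Im (Ln (g u)) = of_int i * pi"
      by (auto simp: sin_zero_iff_int2)
    then show ?thesis by (simp add: \<theta>_def mult.commute)
  qed
  have "\<theta> constant_on S"
  proof (rule continuous_discrete_range_constant[OF S(1)])
    show "continuous_on S \<theta>"
      unfolding \<theta>_def using nz by (intro continuous_intros cont) auto
    fix u assume "u \<in> S"
    then show "\<exists>e>0. \<forall>v. v \<in> S \<and> \<theta> v \<noteq> \<theta> u \<longrightarrow> e \<le> norm (\<theta> v - \<theta> u)"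
      using \<theta> by (intro exI[of _ 1]) (auto intro!: Ints_nonzero_abs_ge1)
  qed
  then have "\<theta> t = \<theta> 0" using t S(2) by (auto simp: constant_on_def)
  then have "Im (Ln (g t)) = 0" using m g0 by (simp add: \<theta>_def)
  then show ?thesis using nz t Im_Ln_eq_0 by blast
qed

text \<open>Finiteness of the second moment is part of the conclusion, so Fatou's lemma is applied
  to nonnegative integrals in \<open>ennreal\<close>.\<close>

lemma (in real_distribution) second_moment_le_Liminf_char:
  assumes h: "filterlim h (at 0) sequentially"
    and bound: "\<forall>\<^sub>F n in sequentially. 2 * (1 - Re (char M (h n))) / (h n)\<^sup>2 \<le> b n"
    and b: "b \<longlonglongrightarrow> B"
  shows "integrable M (\<lambda>x. x\<^sup>2)" and "expectation (\<lambda>x. x\<^sup>2) \<le> B"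
proof -
  define q where "q n x = 2 * (1 - cos (h n * x)) / (h n)\<^sup>2" for n x
  have q_nonneg: "0 \<le> q n x" for n x by (simp add: q_def)
  have q_int: "integrable M (q n)" for n
    unfolding q_def using integrable_cos_mult[of "h n"] by simp
  have q_expectation: "expectation (q n) = 2 * (1 - Re (char M (h n))) / (h n)\<^sup>2" for n
    unfolding q_def Re_char using integrable_cos_mult prob_space by simp
  have q_lim: "(\<lambda>n. q n x) \<longlonglongrightarrow> x\<^sup>2" for x
  proof (cases "x = 0")
    case False
    have "((\<lambda>y. 2 * (1 - cos (y * x)) / y\<^sup>2) \<longlongrightarrow> x * x) (at 0)"
      using False by real_asymp
    from filterlim_compose[OF this h] show ?thesis by (simp add: q_def power2_eq_square[of x])
  qed (simp add: q_def)
  have q_nn: "(\<integral>\<^sup>+x. ennreal (q n x) \<partial>M) = ennreal (expectation (q n))" for n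
    by (rule nn_integral_eq_integral[OF q_int]) (simp add: q_nonneg)
  have "(\<integral>\<^sup>+x. ennreal (x\<^sup>2) \<partial>M) = (\<integral>\<^sup>+x. liminf (\<lambda>n. ennreal (q n x)) \<partial>M)"
    by (intro nn_integral_cong lim_imp_Liminf[symmetric] tendsto_ennrealI q_lim) simp
  also have "\<dots> \<le> liminf (\<lambda>n. \<integral>\<^sup>+x. ennreal (q n x) \<partial>M)"
    by (rule nn_integral_liminf) (simp add: q_def)
  also have "\<dots> \<le> liminf (\<lambda>n. ennreal (b n))"
    using bound by (intro Liminf_mono) (auto simp: q_nn q_expectation ennreal_leI elim!: eventually_mono)
  also have "\<dots> = ennreal B"
    by (intro lim_imp_Liminf tendsto_ennrealI b) simp
  finally have le: "(\<integral>\<^sup>+x. ennreal (x\<^sup>2) \<partial>M) \<le> ennreal B" .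
  then show "integrable M (\<lambda>x. x\<^sup>2)"
    by (intro integrableI_nonneg) (auto simp: le_less_trans)
  \<comment> \<open>\<open>ennreal\<close> sends negative reals to 0, so the bound by
    \<open>ennreal B\<close> yields one by \<open>B\<close> only once \<open>B\<close> is known to
    be nonnegative.\<close>
  have "0 \<le> B"
  proof (rule LIMSEQ_le_const[OF b])
    have "\<forall>\<^sub>F n in sequentially. 0 \<le> b n"
      using bound
    proof eventually_elim
      case (elim n)
      have "0 \<le> expectation (q n)" by (intro integral_nonneg_AE) (simp add: q_nonneg)
      with elim show ?case by (simp add: q_expectation)
    qed
    then show "\<exists>N. \<forall>n\<ge>N. 0 \<le> b n" by (simp add: eventually_sequentially)
  qed
  then show "expectation (\<lambda>x. x\<^sup>2) \<le> B"
    using le by (rule integral_real_bounded)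
qed

text \<open>Near 0 the root equals its real part \<open>r\<close>, and 1 - r^m = (1 - r) S with S =
  1 + r + ... + r^(m-1). The quadratic bound for \<open>M\<close> then gives 2 (1 - r) / t^2 <= v /
  S, which tends to v / m because r tends to 1.\<close>

lemma second_moment_root_le:
  assumes "real_distribution M" "real_distribution N"
    and root: "\<And>t. char N t ^ m = char M t" and real: "\<And>t. Im (char M t) = 0" and m: "m \<ge> 1"
    and int: "integrable M (\<lambda>x. x\<^sup>2)"
  shows "integrable N (\<lambda>x. x\<^sup>2)"
    and "integral\<^sup>L N (\<lambda>x. x\<^sup>2) \<le> integral\<^sup>L M (\<lambda>x. x\<^sup>2) / real m"
proof -
  interpret M: real_distribution M by fact
  interpret N: real_distribution N by fact
  define v where "v = integral\<^sup>L M (\<lambda>x. x\<^sup>2)"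
  define r where "r = (\<lambda>t. Re (char N t))"
  have r_tendsto: "(r \<longlongrightarrow> 1) (at 0)"
    using N.isCont_char[of 0] N.char_zero unfolding r_def isCont_def
    by (auto intro!: tendsto_eq_intros)
  \<comment> \<open>Continuity at 0 supplies positivity of \<open>r\<close> on some interval; the
    cosine bound for the root cannot be used here, as it rests on the moment estimate being
    proved.\<close>
  obtain d where d: "0 < d" "\<And>t. \<bar>t\<bar> < d \<Longrightarrow> 0 < r t"
  proof -
    from order_tendstoD(1)[OF r_tendsto, of 0]
    obtain d where d: "0 < d" "\<And>t. t \<noteq> 0 \<Longrightarrow> \<bar>t\<bar> < d \<Longrightarrow> 0 < r t"
      by (auto simp: eventually_at dist_real_def)
    moreover have "0 < r 0" by (simp add: r_def N.char_zero)
    ultimately show ?thesis using that by metis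
  qed
  have char_N: "char N t = complex_of_real (r t)" if t: "\<bar>t\<bar> < d" for t
  proof -
    have "Im (char N t) = 0"
    proof (rule Im_eq_0_if_power_real[where S = "{-d<..<d}" and g = "char N" and m = m])
      show "continuous_on {-d<..<d} (char N)"
        by (intro continuous_at_imp_continuous_on ballI N.isCont_char)
      show "0 < Re (char N u)" if "u \<in> {-d<..<d}" for u
        using d(2)[of u] that by (auto simp: r_def)
    qed (use d t m root real N.char_zero in auto)
    then show ?thesis by (simp add: r_def complex_eq_iff)
  qed
  define S where "S = (\<lambda>t. \<Sum>k<m. r t ^ k)"
  have bound: "2 * (1 - r t) / t\<^sup>2 \<le> v / S t" if t: "\<bar>t\<bar> < d" "t \<noteq> 0" for t
  proof -
    have S: "0 < S t" unfolding S_def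
      using d(2)[OF t(1)] m by (intro sum_pos) (auto simp: lessThan_empty_iff)
    have "1 - t\<^sup>2 * v / 2 \<le> Re (char M t)"
      unfolding v_def by (rule M.Re_char_ge_quadratic[OF int])
    also have "char M t = complex_of_real (r t ^ m)"
      using root[of t] char_N[OF t(1)] by simp
    finally have "1 - r t ^ m \<le> t\<^sup>2 * v / 2" by simp
    then have "(1 - r t) * S t \<le> t\<^sup>2 * v / 2"
      by (simp add: one_diff_power_eq S_def)
    then show ?thesis using S t(2) by (simp add: field_simps)
  qed
  define h where "h n = 1 / real (Suc n)" for n
  have h: "filterlim h (at 0) sequentially"
    unfolding h_def by real_asymp
  have "((\<lambda>t. v / S t) \<longlongrightarrow> v / (\<Sum>k<m. 1 ^ k)) (at 0)"
    unfolding S_def using m by (intro tendsto_intros r_tendsto) auto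
  from filterlim_compose[OF this h]
  have b: "(\<lambda>n. v / S (h n)) \<longlonglongrightarrow> v / real m" by simp
  have "\<forall>\<^sub>F t in at 0. 2 * (1 - r t) / t\<^sup>2 \<le> v / S t"
    unfolding eventually_at using d(1) bound by (auto simp: dist_real_def)
  from eventually_compose_filterlim[OF this h]
  have ev: "\<forall>\<^sub>F n in sequentially. 2 * (1 - Re (char N (h n))) / (h n)\<^sup>2 \<le> v / S (h n)"
    by (simp add: r_def)
  show "integrable N (\<lambda>x. x\<^sup>2)"
    by (rule N.second_moment_le_Liminf_char(1)[OF h ev b])
  show "integral\<^sup>L N (\<lambda>x. x\<^sup>2) \<le> integral\<^sup>L M (\<lambda>x. x\<^sup>2) / real m"
    using N.second_moment_le_Liminf_char(2)[OF h ev b] by (simp add: v_def)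
qed

section \<open>The cosine bound for divisible symmetric laws\<close>

lemma Re_char_divisible_ge_cos_power:
  assumes "real_distribution M" "m_divisible m M" and real: "\<And>t. Im (char M t) = 0"
    and m: "m \<ge> 1" and int: "integrable M (\<lambda>x. x\<^sup>2)" and s: "s\<^sup>2 = integral\<^sup>L M (\<lambda>x. x\<^sup>2)"
    and t: "\<bar>s * t\<bar> / sqrt (real m) \<le> pi / 2"
  shows "cos (s * t / sqrt (real m)) ^ m \<le> Re (char M t)"
proof -
  interpret M: real_distribution M by fact
  obtain N where N: "real_distribution N" and root: "\<And>t. char N t ^ m = char M t"
    using assms(2) by (auto simp: m_divisible_def)
  interpret N: real_distribution N by fact
  have intN: "integrable N (\<lambda>x. x\<^sup>2)"
    by (rule second_moment_root_le(1)[OF assms(1) N root real m int])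
  define s' where "s' = s / sqrt (real m)"
  have s': "N.expectation (\<lambda>x. x\<^sup>2) \<le> s'\<^sup>2"
    using second_moment_root_le(2)[OF assms(1) N root real m int] m
    by (simp add: s'_def power_divide s)
  have ge: "cos (s' * u) \<le> Re (char N u)" if "\<bar>s' * u\<bar> \<le> pi / 2" for u
    by (rule N.Re_char_ge_cos[OF intN s' that])
  \<comment> \<open>Strictness keeps the cosine, and with it the real part of the root, positive on
    all of [-|u|, |u|]. This gives realness of the root and allows taking \<open>m\<close>-th
    powers.\<close>
  have strict: "cos (s' * u) ^ m \<le> Re (char M u)" if u: "\<bar>s' * u\<bar> < pi / 2" for u
  proof -
    have pos: "0 < cos (s' * w)" if "\<bar>w\<bar> \<le> \<bar>u\<bar>" for w
    proof -
      have "\<bar>s' * w\<bar> \<le> \<bar>s' * u\<bar>" using that by (simp add: abs_mult mult_left_mono)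
      with u show ?thesis by (intro cos_gt_zero_pi) auto
    qed
    have "Im (char N u) = 0"
    proof (rule Im_eq_0_if_power_real[where S = "{-\<bar>u\<bar>..\<bar>u\<bar>}" and g = "char N" and m = m])
      show "continuous_on {-\<bar>u\<bar>..\<bar>u\<bar>} (char N)"
        by (intro continuous_at_imp_continuous_on ballI N.isCont_char)
      show "0 < Re (char N w)" if "w \<in> {-\<bar>u\<bar>..\<bar>u\<bar>}" for w
      proof -
        have w: "\<bar>w\<bar> \<le> \<bar>u\<bar>" using that by auto
        then have "\<bar>s' * w\<bar> \<le> \<bar>s' * u\<bar>" by (simp add: abs_mult mult_left_mono)
        then show ?thesis using ge[of w] pos[OF w] u by simp
      qed
    qed (use m root real N.char_zero in auto)
    then have "char N u = complex_of_real (Re (char N u))"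
      by (simp add: complex_eq_iff)
    then have "char M u = complex_of_real (Re (char N u) ^ m)"
      using root[of u] by (metis of_real_power)
    moreover have "cos (s' * u) ^ m \<le> Re (char N u) ^ m"
      using ge[of u] u pos[of u] by (intro power_mono) auto
    ultimately show ?thesis by simp
  qed
  have t': "\<bar>s' * t\<bar> \<le> pi / 2" using t by (simp add: s'_def abs_mult)
  have "cos (s' * t) ^ m \<le> Re (char M t)"
  \<comment> \<open>The endpoint pi / 2, where the cosine vanishes, is reached by continuity: the
    factors n / (n + 1) < 1 move \<open>t\<close> strictly inside the range.\<close>
  proof (rule tendsto_le)
    define c where "c = (\<lambda>n. real n / real (Suc n))"
    have c: "c \<longlonglongrightarrow> 1" unfolding c_def by real_asymp
    show "(\<lambda>n. cos (s' * (c n * t)) ^ m) \<longlonglongrightarrow> cos (s' * t) ^ m"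
      by (auto intro!: tendsto_eq_intros c)
    have "(\<lambda>n. c n * t) \<longlonglongrightarrow> t" by (auto intro!: tendsto_eq_intros c)
    then show "(\<lambda>n. Re (char M (c n * t))) \<longlonglongrightarrow> Re (char M t)"
      by (intro tendsto_Re isCont_tendsto_compose[OF M.isCont_char])
    have "\<bar>s' * (c n * t)\<bar> < pi / 2" for n
    proof -
      have "\<bar>s' * (c n * t)\<bar> = c n * \<bar>s' * t\<bar>" by (simp add: abs_mult c_def)
      also have "\<dots> \<le> c n * (pi / 2)" using t' by (intro mult_left_mono) (auto simp: c_def)
      also have "\<dots> < pi / 2" by (simp add: c_def field_simps)
      finally show ?thesis .
    qed
    then show "\<forall>\<^sub>F n in sequentially. cos (s' * (c n * t)) ^ m \<le> Re (char M (c n * t))"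
      using strict by auto
  qed simp
  then show ?thesis by (simp add: s'_def)
qed

text \<open>The functions sin (t x) and x are odd, and the law is invariant under reflection. The
  vanishing mean identifies the variance with the second moment.\<close>

lemma
  assumes "real_distribution M" and sym: "symmetric_distribution M"
  shows Im_char_symmetric: "Im (char M t) = 0"
    and expectation_symmetric: "integral\<^sup>L M (\<lambda>x. x) = 0"
proof -
  interpret real_distribution M by fact
  have D: "distr M borel uminus = M" using sym by (simp add: symmetric_distribution_def)
  have odd: "integral\<^sup>L M f = 0"
    if "f \<in> borel_measurable borel" "\<And>x. f (- x) = - f x" for f :: "real \<Rightarrow> real"
  proof -
    have "integral\<^sup>L M f = integral\<^sup>L M (\<lambda>x. f (- x))"
      using integral_distr[of uminus M borel f] that(1) D by simp
    also have "\<dots> = - integral\<^sup>L M f" by (simp add: that(2))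
    finally show ?thesis by linarith
  qed
  have "integrable M (\<lambda>x. iexp (t * x))"
    using integrable_iexp[of "\<lambda>x. complex_of_real (t * x)"] by simp
  from integral_Im[OF this] have "Im (char M t) = integral\<^sup>L M (\<lambda>x. sin (t * x))"
    unfolding char_def by (simp add: Im_exp)
  then show "Im (char M t) = 0"
    using odd[of "\<lambda>x. sin (t * x)"] by simp
  show "integral\<^sup>L M (\<lambda>x. x) = 0"
    using odd[of "\<lambda>x. x"] by simp
qed

theorem theorem1p4:
  shows "\<exists>C :: real list \<Rightarrow> real.
    \<forall>(M :: real measure) (m :: nat).
      real_distribution M \<longrightarrow> m \<ge> 1 \<longrightarrow>
      \<not> degenerate_distribution M \<longrightarrow> m_divisible m M \<longrightarrow>
      symmetric_distribution M \<longrightarrow> finite_moment M 10 \<longrightarrow>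
      (let \<sigma> = std_dev M; c = C (map (abs_moment M) [1..<11]) in
        c > 0 \<and>
        (\<forall>t :: real. \<bar>t\<bar> \<le> min (c * sqrt (real m)) (pi * sqrt (real m) / (2 * \<sigma>)) \<longrightarrow>
           cos (\<sigma> * t / sqrt (real m)) ^ m \<le> Re (char M t)))"
proof (intro exI[of _ "\<lambda>_. 1"] allI impI)
  fix M :: "real measure" and m :: nat
  assume M: "real_distribution M" and m: "m \<ge> 1" and div: "m_divisible m M"
    and sym: "symmetric_distribution M" and fin: "finite_moment M 10"
  interpret real_distribution M by fact
  have int: "integrable M (\<lambda>x. x\<^sup>2)"
  proof (rule Bochner_Integration.integrable_bound)
    show "integrable M (\<lambda>x. 1 + \<bar>x\<bar> ^ 10)" using fin by (simp add: finite_moment_def)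
    have "x\<^sup>2 \<le> 1 + \<bar>x\<bar> ^ 10" for x :: real
    proof (cases "\<bar>x\<bar> \<le> 1")
      case True
      then show ?thesis using power_le_one[of "\<bar>x\<bar>" 2] by (simp add: add_increasing2)
    next
      case False
      then show ?thesis using power_increasing[of 2 10 "\<bar>x\<bar>"] by simp
    qed
    then show "AE x in M. norm (x\<^sup>2) \<le> norm (1 + \<bar>x\<bar> ^ 10)" by simp
  qed simp
  define s where "s = std_dev M"
  have s: "s\<^sup>2 = expectation (\<lambda>x. x\<^sup>2)"
    by (simp add: s_def std_dev_def expectation_symmetric[OF M sym])
  have s_nonneg: "0 \<le> s"
    by (simp add: s_def std_dev_def)
  have "cos (s * t / sqrt (real m)) ^ m \<le> Re (char M t)"
    if t: "\<bar>t\<bar> \<le> pi * sqrt (real m) / (2 * s)" for t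
  proof (rule Re_char_divisible_ge_cos_power[OF M div Im_char_symmetric[OF M sym] m int s])
    show "\<bar>s * t\<bar> / sqrt (real m) \<le> pi / 2"
      \<comment> \<open>For \<open>s = 0\<close> the quotient bounding |t| is 0 by convention, but
        the goal holds at once since s t = 0.\<close>
      using t s_nonneg m by (cases "s = 0") (auto simp: abs_mult field_simps)
  qed
  then show "let \<sigma> = std_dev M; c = 1 in c > 0 \<and>
      (\<forall>t :: real. \<bar>t\<bar> \<le> min (c * sqrt (real m)) (pi * sqrt (real m) / (2 * \<sigma>)) \<longrightarrow>
         cos (\<sigma> * t / sqrt (real m)) ^ m \<le> Re (char M t))"
    by (simp add: s_def Let_def)
qed

end
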